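(* Let $c^\ast$ be the optimal value of the linear inverse problem (LIP): minimize $c(f)$ over $f\in\mathbb{H}$ subject to $\|x-\phi(f)\|\le\epsilon$. Then the following assertions hold. (i) Every optimal solution $f^\ast$ of the LIP satisfies $e(f^\ast)<\epsilon^2$. (ii) Let $f^\ast$ be an optimal solution of the LIP, and consider any $\bar\epsilon\in(0,\epsilon)$ and $\hat\eta$ such that $e(f^\ast)\le\bar\epsilon^2<\epsilon^2$ and $c^\ast<\hat\eta$. Then the optimization problem $$\min_{h\in\mathcal{H}(\bar\epsilon,\hat\eta)}\ \eta(h)$$ is a smooth convex optimization problem (the set $\mathcal{H}(\bar\epsilon,\hat\eta)$ is convex, and $\eta$ is convex and $\beta$-smooth on it for some $\beta\geq 0$) which is equivalent to the LIP; that is, its optimal value equals $c^\ast$, and $h^\ast$ is a solution of it if and only if $c^\ast h^\ast$ is an optimal solution of the LIP.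
   Context: $\mathbb{H}$ is a finite-dimensional real Hilbert space with inner product $\langle\cdot,\cdot\rangle$; $\mathbb{R}^n$ carries an inner product (also written $\langle\cdot,\cdot\rangle$) with associated norm $\|\cdot\|$; $\phi:\mathbb{H}\to\mathbb{R}^n$ is linear; $x\in\mathbb{R}^n$, $\epsilon>0$. Standing assumptions. (1) The cost $c:\mathbb{H}\to\mathbb{R}$ is positively homogeneous ($c(rf)=rc(f)$ for all $r\ge0$, $f\in\mathbb{H}$), and $B_c:=\{f\in\mathbb{H}:c(f)\le1\}$ is compact and convex. (2) $\|x\|>\epsilon>0$ and there exists $f\in\mathbb{H}$ with $\|x-\phi(f)\|<\epsilon$. Definitions. For $h\in\mathbb{H}$, $e(h):=\min_{\theta\in\mathbb{R}}\|x-\theta\phi(h)\|^2$, i.e. $e(h)=\|x\|^2$ if $\phi(h)=0$ and $e(h)=\|x\|^2-|\langle x,\phi(h)\rangle|^2/\|\phi(h)\|^2$ otherwise. For $\bar\epsilon\in(0,\epsilon]$, $\mathcal{K}(\bar\epsilon):=\{h\in\mathbb{H}:\langle x,\phi(h)\rangle>0,\ e(h)\le\bar\epsilon^2\}$. The function $\eta:\mathcal{K}(\epsilon)\to[0,\infty)$ is $$\eta(h):=\frac{\|x\|^2-\epsilon^2}{\langle x,\phi(h)\rangle+\|\phi(h)\|\sqrt{\epsilon^2-e(h)}}.$$ $\mathcal{H}(\bar\epsilon,\hat\eta):=\{h\in B_c\cap\mathcal{K}(\bar\epsilon):\eta(h)\le\hat\eta\}$. A function $\eta$ is $\beta$-smooth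 on a convex set $S$ if $\|\nabla\eta(h)-\nabla\eta(h')\|\le\beta\|h-h'\|$ for all $h,h'\in S$ (norm of $\mathbb{H}$). *)

theory Defs
  imports "HOL-Analysis.Analysis"
begin

definition optimal_value :: "('a \<Rightarrow> real) \<Rightarrow> 'a set \<Rightarrow> real"
  where "optimal_value f S = (INF s\<in>S. f s)"

definition solution_of :: "('a \<Rightarrow> real) \<Rightarrow> 'a set \<Rightarrow> 'a \<Rightarrow> bool"
  where "solution_of f S s \<longleftrightarrow> is_arg_min f (\<lambda>s. s \<in> S) s"

definition positively_homogeneous :: "('h::real_vector \<Rightarrow> real) \<Rightarrow> bool"
  where "positively_homogeneous c \<longleftrightarrow> (\<forall>r\<ge>0. \<forall>f. c (r *\<^sub>R f) = r * c f)"

definition cost_ball :: "('h \<Rightarrow> real) \<Rightarrow> 'h set"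
  where "cost_ball c = {f. c f \<le> 1}"

definition lip_feasible :: "('h \<Rightarrow> 'v::real_inner) \<Rightarrow> 'v \<Rightarrow> real \<Rightarrow> 'h set"
  where "lip_feasible \<phi> x \<epsilon> = {f. norm (x - \<phi> f) \<le> \<epsilon>}"

(* The infimum over theta is attained; see err_is_min and err_closed_form. *)
definition err :: "('h \<Rightarrow> 'v::real_inner) \<Rightarrow> 'v \<Rightarrow> 'h \<Rightarrow> real"
  where "err \<phi> x h = (INF \<theta>::real. (norm (x - \<theta> *\<^sub>R \<phi> h))\<^sup>2)"

definition K_set :: "('h \<Rightarrow> 'v::real_inner) \<Rightarrow> 'v \<Rightarrow> real \<Rightarrow> 'h set"
  where "K_set \<phi> x \<delta> = {h. x \<bullet> \<phi> h > 0 \<and> err \<phi> x h \<le> \<delta>\<^sup>2}"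

(* Only the values on K_set \<phi> x \<epsilon> are meaningful. *)
definition eta :: "('h \<Rightarrow> 'v::real_inner) \<Rightarrow> 'v \<Rightarrow> real \<Rightarrow> 'h \<Rightarrow> real"
  where "eta \<phi> x \<epsilon> h =
    ((norm x)\<^sup>2 - \<epsilon>\<^sup>2) / (x \<bullet> \<phi> h + norm (\<phi> h) * sqrt (\<epsilon>\<^sup>2 - err \<phi> x h))"

definition H_set ::
    "('h \<Rightarrow> real) \<Rightarrow> ('h \<Rightarrow> 'v::real_inner) \<Rightarrow> 'v \<Rightarrow> real \<Rightarrow> real \<Rightarrow> real \<Rightarrow> 'h set"
  where "H_set c \<phi> x \<epsilon> \<delta> M = {h \<in> cost_ball c \<inter> K_set \<phi> x \<delta>. eta \<phi> x \<epsilon> h \<le> M}"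

(* GDERIV is the two-sided gradient in the ambient space. For eta on H_set with \<delta> < \<epsilon> this
   does not see the values of eta outside K_set \<phi> x \<epsilon>, because K_set \<phi> x \<delta> lies in the
   interior of K_set \<phi> x \<epsilon>. *)
definition beta_smooth_on :: "real \<Rightarrow> ('h::real_inner \<Rightarrow> real) \<Rightarrow> 'h set \<Rightarrow> bool"
  where "beta_smooth_on \<beta> f S \<longleftrightarrow>
    (\<exists>G. (\<forall>h\<in>S. GDERIV f h :> G h) \<and>
         (\<forall>h\<in>S. \<forall>h'\<in>S. norm (G h - G h') \<le> \<beta> * norm (h - h')))"

lemma err_aux:
  fixes x v :: "'v::real_inner"
  defines "m \<equiv> (if v = 0 then (norm x)\<^sup>2 else (norm x)\<^sup>2 - \<bar>x \<bullet> v\<bar>\<^sup>2 / (norm v)\<^sup>2)"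
  shows "m \<le> (norm (x - \<theta> *\<^sub>R v))\<^sup>2"
    and "(norm (x - (x \<bullet> v / (norm v)\<^sup>2) *\<^sub>R v))\<^sup>2 = m"
proof -
  have sq: "(norm (x - t *\<^sub>R v))\<^sup>2 = m + (t - x \<bullet> v / (norm v)\<^sup>2)\<^sup>2 * (norm v)\<^sup>2"
    if "v \<noteq> 0" for t
  proof -
    define n a where "n = (norm v)\<^sup>2" and "a = x \<bullet> v"
    have "n \<noteq> 0" using that by (simp add: n_def)
    have "(norm (x - t *\<^sub>R v))\<^sup>2 = (norm x)\<^sup>2 - 2 * t * a + t\<^sup>2 * n"
      unfolding n_def a_def power2_norm_eq_inner
      by (simp add: inner_diff_left inner_diff_right inner_commute power2_eq_square)
    also have "\<dots> = (norm x)\<^sup>2 - a\<^sup>2 / n + (t - a / n)\<^sup>2 * n"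
      using \<open>n \<noteq> 0\<close> by (simp add: power2_eq_square divide_simps) (simp add: algebra_simps)
    finally show ?thesis
      using that by (simp add: m_def n_def a_def)
  qed
  show "m \<le> (norm (x - \<theta> *\<^sub>R v))\<^sup>2"
  proof (cases "v = 0")
    case True
    then show ?thesis by (simp add: m_def)
  next
    case False
    show ?thesis unfolding sq[OF False] by simp
  qed
  show "(norm (x - (x \<bullet> v / (norm v)\<^sup>2) *\<^sub>R v))\<^sup>2 = m"
  proof (cases "v = 0")
    case True
    then show ?thesis by (simp add: m_def)
  next
    case False
    show ?thesis unfolding sq[OF False] by simp
  qed
qed

lemma err_closed_form:
  "err \<phi> x h = (if \<phi> h = 0 then (norm x)\<^sup>2
               else (norm x)\<^sup>2 - \<bar>x \<bullet> \<phi> h\<bar>\<^sup>2 / (norm (\<phi> h))\<^sup>2)"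
  unfolding err_def
proof (rule cInf_eq_minimum)
  show "(if \<phi> h = 0 then (norm x)\<^sup>2 else (norm x)\<^sup>2 - \<bar>x \<bullet> \<phi> h\<bar>\<^sup>2 / (norm (\<phi> h))\<^sup>2)
      \<in> range (\<lambda>\<theta>. (norm (x - \<theta> *\<^sub>R \<phi> h))\<^sup>2)"
    by (rule range_eqI, rule sym, rule err_aux(2))
next
  fix y assume "y \<in> range (\<lambda>\<theta>. (norm (x - \<theta> *\<^sub>R \<phi> h))\<^sup>2)"
  then obtain \<theta> where y: "y = (norm (x - \<theta> *\<^sub>R \<phi> h))\<^sup>2" by (rule rangeE)
  show "(if \<phi> h = 0 then (norm x)\<^sup>2 else (norm x)\<^sup>2 - \<bar>x \<bullet> \<phi> h\<bar>\<^sup>2 / (norm (\<phi> h))\<^sup>2) \<le> y"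
    unfolding y by (rule err_aux(1))
qed

lemma err_is_min:
  "\<exists>\<theta>::real. err \<phi> x h = (norm (x - \<theta> *\<^sub>R \<phi> h))\<^sup>2 \<and>
     (\<forall>t::real. (norm (x - \<theta> *\<^sub>R \<phi> h))\<^sup>2 \<le> (norm (x - t *\<^sub>R \<phi> h))\<^sup>2)"
  unfolding err_closed_form
  by (intro exI[of _ "x \<bullet> \<phi> h / (norm (\<phi> h))\<^sup>2"], unfold err_aux(2))
     (intro conjI refl allI err_aux(1))

end

theory Submission
  imports Defs
begin

text \<open>For \<open>h\<close> in \<open>K_set \<phi> x \<epsilon>\<close>, \<open>eta h\<close> is the least \<open>\<theta>\<close> with
  \<open>norm (x - \<theta> *\<^sub>R \<phi> h) \<le> \<epsilon>\<close>. Hence \<open>eta h *\<^sub>R h\<close> is feasible and costs at most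
  \<open>eta h\<close> when \<open>c h \<le> 1\<close>, so the optimal value \<open>m\<close> of the linear inverse problem satisfies
  \<open>m \<le> eta h\<close>, and \<open>(1 / m) *\<^sub>R fs\<close> attains this bound. As a function of \<open>s = 1 / \<theta>\<close> and
  \<open>h\<close> the constraint is a convex cone, so \<open>1 / eta\<close> is concave and \<open>eta\<close> is convex. On
  \<open>H_set\<close> the conditions \<open>eta h \<le> M\<close> and \<open>\<delta> < \<epsilon>\<close> keep the denominator of \<open>eta\<close> and the
  radicand in it away from zero, so the gradient is Lipschitz on this bounded set. Only one optimal
  \<open>fs\<close> is assumed to satisfy \<open>err \<phi> x fs \<le> \<delta>\<^sup>2\<close>, but \<open>\<phi> fs\<close> is the same for all
  optimal \<open>fs\<close>, by strict convexity of the norm.\<close>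

section \<open>Positively homogeneous costs\<close>

lemma cost_zero:
  assumes "positively_homogeneous c"
  shows "c 0 = 0"
  using assms unfolding positively_homogeneous_def by (metis mult_zero_left order_refl scaleR_zero_left)

lemma cost_scale:
  assumes "positively_homogeneous c" "0 \<le> r"
  shows "c (r *\<^sub>R f) = r * c f"
  using assms unfolding positively_homogeneous_def by blast

text \<open>If \<open>c f\<close> were nonpositive, homogeneity would put the whole ray through
  \<open>f\<close> into the unit ball of \<open>c\<close>, contradicting boundedness.\<close>

lemma cost_pos:
  fixes c :: "'h::real_normed_vector \<Rightarrow> real"
  assumes hom: "positively_homogeneous c" and bdd: "bounded (cost_ball c)" and "f \<noteq> 0"
  shows "0 < c f"
proof (rule ccontr)
  assume "\<not> 0 < c f"
  obtain B where B: "\<And>g. c g \<le> 1 \<Longrightarrow> norm g \<le> B"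
    using bdd unfolding bounded_iff cost_ball_def by auto
  \<comment> \<open>Scales \<open>f\<close> to a vector of norm \<open>\<bar>B\<bar> + 1\<close>,
    beyond the bound of the ball.\<close>
  define r where "r = (\<bar>B\<bar> + 1) / norm f"
  have "r \<ge> 0" by (simp add: r_def)
  then have "c (r *\<^sub>R f) \<le> 1"
    using cost_scale[OF hom] \<open>\<not> 0 < c f\<close>
    by (smt (verit) mult_nonneg_nonneg mult_minus_right)
  then have "norm (r *\<^sub>R f) \<le> B" by (rule B)
  moreover have "norm (r *\<^sub>R f) = \<bar>B\<bar> + 1"
    using \<open>f \<noteq> 0\<close> by (simp add: r_def)
  ultimately show False by linarith
qed

text \<open>\<open>c\<close> is the gauge of its unit ball: the normalized vectors
  \<open>f / c f\<close> and \<open>g / c g\<close> lie in the ball, and averaging them with weights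
  proportional to \<open>c f\<close> and \<open>c g\<close> gives
  \<open>(f + g) / (c f + c g)\<close>.\<close>

lemma cost_subadditive:
  fixes c :: "'h::real_normed_vector \<Rightarrow> real"
  assumes hom: "positively_homogeneous c" and bdd: "bounded (cost_ball c)"
    and conv: "convex (cost_ball c)"
  shows "c (f + g) \<le> c f + c g"
proof (cases "f = 0 \<or> g = 0")
  case True
  then show ?thesis using cost_zero[OF hom] by auto
next
  case False
  define s t where "s = c f" and "t = c g"
  have pos: "0 < s" "0 < t" using False cost_pos[OF hom bdd] by (auto simp: s_def t_def)
  have "(1/s) *\<^sub>R f \<in> cost_ball c" "(1/t) *\<^sub>R g \<in> cost_ball c"
    using pos cost_scale[OF hom, of "1/s" f] cost_scale[OF hom, of "1/t" g]
    by (simp_all add: cost_ball_def flip: s_def t_def)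
  then have "(s/(s+t)) *\<^sub>R (1/s) *\<^sub>R f + (t/(s+t)) *\<^sub>R (1/t) *\<^sub>R g \<in> cost_ball c"
    using pos by (intro convexD[OF conv]) (auto simp flip: add_divide_distrib)
  also have "(s/(s+t)) *\<^sub>R (1/s) *\<^sub>R f + (t/(s+t)) *\<^sub>R (1/t) *\<^sub>R g = (1/(s+t)) *\<^sub>R (f + g)"
    using pos by (simp add: scaleR_add_right)
  finally have "c (f + g) / (s + t) \<le> 1"
    using pos cost_scale[OF hom, of "1/(s+t)" "f+g"] by (simp add: cost_ball_def)
  then show ?thesis using pos by (simp add: s_def t_def)
qed

lemma cost_combination:
  fixes c :: "'h::real_normed_vector \<Rightarrow> real"
  assumes hom: "positively_homogeneous c" and bdd: "bounded (cost_ball c)"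
    and conv: "convex (cost_ball c)" and "0 \<le> u" "0 \<le> v"
  shows "c (u *\<^sub>R f + v *\<^sub>R g) \<le> u * c f + v * c g"
  using cost_subadditive[OF hom bdd conv, of "u *\<^sub>R f" "v *\<^sub>R g"] assms
  by (simp add: cost_scale)

section \<open>The function \<open>eta\<close> as a least feasible scaling\<close>

lemma norm_diff_scaleR_squared:
  fixes x v :: "'v::real_inner"
  shows "(norm (x - \<theta> *\<^sub>R v))\<^sup>2 = (norm x)\<^sup>2 - 2 * \<theta> * (x \<bullet> v) + \<theta>\<^sup>2 * (norm v)\<^sup>2"
  unfolding power2_norm_eq_inner
  by (simp add: inner_diff_left inner_diff_right inner_commute power2_eq_square)

lemma err_le: "err \<phi> x h \<le> (norm (x - \<theta> *\<^sub>R \<phi> h))\<^sup>2"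
  unfolding err_closed_form by (rule err_aux(1))

text \<open>This closed form holds without any side condition, also where the radicand is negative,
  because \<^term>\<open>sqrt\<close> is an odd function.\<close>
lemma eta_eq:
  "eta \<phi> x \<epsilon> h = ((norm x)\<^sup>2 - \<epsilon>\<^sup>2) /
    (x \<bullet> \<phi> h + sqrt ((x \<bullet> \<phi> h)\<^sup>2 - ((norm x)\<^sup>2 - \<epsilon>\<^sup>2) * (norm (\<phi> h))\<^sup>2))"
proof -
  have "norm (\<phi> h) * sqrt (\<epsilon>\<^sup>2 - err \<phi> x h)
      = sqrt ((norm (\<phi> h))\<^sup>2 * (\<epsilon>\<^sup>2 - err \<phi> x h))"
    by (simp add: real_sqrt_mult)
  also have "(norm (\<phi> h))\<^sup>2 * (\<epsilon>\<^sup>2 - err \<phi> x h)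
      = (x \<bullet> \<phi> h)\<^sup>2 - ((norm x)\<^sup>2 - \<epsilon>\<^sup>2) * (norm (\<phi> h))\<^sup>2"
    unfolding err_closed_form by (simp add: field_simps)
  finally show ?thesis unfolding eta_def by simp
qed

text \<open>Together with \<open>K_setE\<close> this turns membership into the existence of a
  positive scaling within distance \<open>\<delta>\<close> of \<open>x\<close>. The sign of
  \<open>x \<bullet> \<phi> h\<close> follows because \<open>0\<close> is farther from
  \<open>x\<close> than \<open>\<delta>\<close>.\<close>

lemma K_setI:
  assumes "0 < \<theta>" "norm (x - \<theta> *\<^sub>R \<phi> h) \<le> \<delta>" "\<delta> < norm x"
  shows "h \<in> K_set \<phi> x \<delta>"
proof -
  have "0 \<le> \<delta>" using assms(2) norm_ge_zero order_trans by blast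
  have le: "(norm (x - \<theta> *\<^sub>R \<phi> h))\<^sup>2 \<le> \<delta>\<^sup>2"
    using assms(2) by (simp add: power_mono)
  have "\<delta>\<^sup>2 < (norm x)\<^sup>2" using assms(3) \<open>0 \<le> \<delta>\<close> by (simp add: power_strict_mono)
  then have "0 < 2 * \<theta> * (x \<bullet> \<phi> h)"
    using le zero_le_power2[of "\<theta> * norm (\<phi> h)"]
    unfolding norm_diff_scaleR_squared power_mult_distrib by linarith
  then have "0 < x \<bullet> \<phi> h" using \<open>0 < \<theta>\<close> by (simp add: zero_less_mult_iff)
  then show ?thesis
    using err_le[of \<phi> x h \<theta>] le by (simp add: K_set_def)
qed

text \<open>The witness is the least-squares coefficient
  \<open>x \<bullet> \<phi> h / (norm (\<phi> h))\<^sup>2\<close>, at which the infimum in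
  \<open>err\<close> is attained.\<close>

lemma K_setE:
  assumes "h \<in> K_set \<phi> x \<delta>" "0 \<le> \<delta>"
  obtains \<theta> where "0 < \<theta>" "norm (x - \<theta> *\<^sub>R \<phi> h) \<le> \<delta>"
proof
  have "\<phi> h \<noteq> 0" "0 < x \<bullet> \<phi> h" "err \<phi> x h \<le> \<delta>\<^sup>2"
    using assms by (auto simp: K_set_def)
  then show "0 < x \<bullet> \<phi> h / (norm (\<phi> h))\<^sup>2" by simp
  have "(norm (x - (x \<bullet> \<phi> h / (norm (\<phi> h))\<^sup>2) *\<^sub>R \<phi> h))\<^sup>2 \<le> \<delta>\<^sup>2"
    using \<open>err \<phi> x h \<le> \<delta>\<^sup>2\<close> unfolding err_aux(2) err_closed_form .
  then show "norm (x - (x \<bullet> \<phi> h / (norm (\<phi> h))\<^sup>2) *\<^sub>R \<phi> h) \<le> \<delta>"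
    using assms(2) power2_le_imp_le by blast
qed

lemma K_set_mono:
  assumes "h \<in> K_set \<phi> x \<delta>" "0 \<le> \<delta>" "\<delta> \<le> \<epsilon>"
  shows "h \<in> K_set \<phi> x \<epsilon>"
  using assms power_mono[of \<delta> \<epsilon> 2] unfolding K_set_def mem_Collect_eq by linarith

text \<open>For \<delta> = \<epsilon> this makes the radicand in \<open>eta_eq\<close> nonnegative;
  for \<delta> < \<epsilon> it keeps that radicand above a positive multiple of
  \<open>(x \<bullet> \<phi> h)\<^sup>2\<close>.\<close>

lemma K_set_discriminant:
  assumes "h \<in> K_set \<phi> x \<delta>"
  shows "((norm x)\<^sup>2 - \<delta>\<^sup>2) * (norm (\<phi> h))\<^sup>2 \<le> (x \<bullet> \<phi> h)\<^sup>2"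
proof -
  have n: "0 < (norm (\<phi> h))\<^sup>2" and "err \<phi> x h \<le> \<delta>\<^sup>2" using assms by (auto simp: K_set_def)
  then have "(norm x)\<^sup>2 - \<delta>\<^sup>2 \<le> (x \<bullet> \<phi> h)\<^sup>2 / (norm (\<phi> h))\<^sup>2"
    by (simp add: err_closed_form)
  then show ?thesis using n by (simp only: pos_le_divide_eq)
qed

text \<open>The squared constraint is the quadratic inequality
  \<open>n\<^sup>2 \<theta>\<^sup>2 - 2 a \<theta> + D \<le> 0\<close>, whose smaller root is \<open>D / (a + q)\<close>.\<close>
lemma
  assumes h: "h \<in> K_set \<phi> x \<epsilon>" and "0 \<le> \<epsilon>" "\<epsilon> < norm x"
  shows eta_pos: "0 < eta \<phi> x \<epsilon> h"
    and eta_feasible: "norm (x - eta \<phi> x \<epsilon> h *\<^sub>R \<phi> h) \<le> \<epsilon>"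
    and eta_le: "\<And>\<theta>. norm (x - \<theta> *\<^sub>R \<phi> h) \<le> \<epsilon> \<Longrightarrow> eta \<phi> x \<epsilon> h \<le> \<theta>"
proof -
  define a n D where "a = x \<bullet> \<phi> h" and "n = norm (\<phi> h)" and "D = (norm x)\<^sup>2 - \<epsilon>\<^sup>2"
  define q where "q = sqrt (a\<^sup>2 - D * n\<^sup>2)"
  have a: "0 < a" using h by (simp add: K_set_def a_def)
  then have n: "0 < n" by (auto simp: a_def n_def)
  have D: "0 < D" using assms by (simp add: D_def power_strict_mono)
  have disc: "0 \<le> a\<^sup>2 - D * n\<^sup>2"
    using K_set_discriminant[OF h] by (simp add: a_def n_def D_def)
  have q: "0 \<le> q" "q\<^sup>2 = a\<^sup>2 - D * n\<^sup>2" using disc by (auto simp: q_def)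
  have eta: "eta \<phi> x \<epsilon> h = D / (a + q)"
    unfolding eta_eq q_def a_def n_def D_def by simp
  show "0 < eta \<phi> x \<epsilon> h" unfolding eta using a q D by simp
  \<comment> \<open>Factoring the difference of squares rewrites \<open>D / (a + q)\<close> as
    \<open>(a - q) / n\<^sup>2\<close>, the form that completing the square produces.\<close>
  have prod: "D * n\<^sup>2 = (a + q) * (a - q)" using q by (simp add: power2_eq_square algebra_simps)
  have eta': "eta \<phi> x \<epsilon> h = (a - q) / n\<^sup>2"
    unfolding eta using a q n prod by (simp add: frac_eq_eq mult.commute)
  have sq: "(norm (x - \<theta> *\<^sub>R \<phi> h))\<^sup>2 - \<epsilon>\<^sup>2 = ((n\<^sup>2 * \<theta> - a)\<^sup>2 - q\<^sup>2) / n\<^sup>2" for \<theta>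
  proof -
    have "(norm (x - \<theta> *\<^sub>R \<phi> h))\<^sup>2 - \<epsilon>\<^sup>2 = D - 2 * \<theta> * a + \<theta>\<^sup>2 * n\<^sup>2"
      unfolding norm_diff_scaleR_squared by (simp add: a_def n_def D_def)
    moreover have "(n\<^sup>2 * \<theta> - a)\<^sup>2 - q\<^sup>2 = (D - 2 * \<theta> * a + \<theta>\<^sup>2 * n\<^sup>2) * n\<^sup>2"
      using q(2) by (simp add: power2_eq_square algebra_simps)
    ultimately show ?thesis using n by simp
  qed
  have "n\<^sup>2 * eta \<phi> x \<epsilon> h - a = - q" using n by (simp add: eta')
  then have "(norm (x - eta \<phi> x \<epsilon> h *\<^sub>R \<phi> h))\<^sup>2 = \<epsilon>\<^sup>2"
    using sq[of "eta \<phi> x \<epsilon> h"] by simp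
  then show "norm (x - eta \<phi> x \<epsilon> h *\<^sub>R \<phi> h) \<le> \<epsilon>"
    using \<open>0 \<le> \<epsilon>\<close> by (simp add: power2_eq_imp_eq)
  fix \<theta> assume "norm (x - \<theta> *\<^sub>R \<phi> h) \<le> \<epsilon>"
  then have "(norm (x - \<theta> *\<^sub>R \<phi> h))\<^sup>2 \<le> \<epsilon>\<^sup>2" by (simp add: power_mono)
  then have "((n\<^sup>2 * \<theta> - a)\<^sup>2 - q\<^sup>2) / n\<^sup>2 \<le> 0" using sq[of \<theta>] by linarith
  then have "(n\<^sup>2 * \<theta> - a)\<^sup>2 \<le> q\<^sup>2" using n by (simp add: divide_le_0_iff not_le)
  then have "\<bar>n\<^sup>2 * \<theta> - a\<bar> \<le> q" using q(1) power2_le_imp_le[of "\<bar>n\<^sup>2 * \<theta> - a\<bar>" q] by simp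
  then have "a - q \<le> \<theta> * n\<^sup>2" by (simp add: abs_le_iff mult.commute)
  moreover have "0 < n\<^sup>2" using n by simp
  ultimately have "(a - q) / n\<^sup>2 \<le> \<theta>" by (simp only: pos_divide_le_eq)
  then show "eta \<phi> x \<epsilon> h \<le> \<theta>" by (simp only: eta')
qed

section \<open>Convexity\<close>

text \<open>In terms of \<open>s = 1 / \<theta>\<close> the constraint \<open>norm (x - \<theta> *\<^sub>R \<phi> h) \<le> \<delta>\<close> becomes
  \<open>norm (s *\<^sub>R x - \<phi> h) \<le> \<delta> * s\<close>, which cuts out a convex cone of pairs \<open>(s, h)\<close>.\<close>
lemma scaling_combination:
  fixes \<phi> :: "'h::real_vector \<Rightarrow> 'v::real_inner"
  assumes "linear \<phi>" "0 \<le> u" "0 \<le> v" "u + v = 1" "0 < \<theta>" "0 < \<theta>'"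
    and h: "norm (x - \<theta> *\<^sub>R \<phi> h) \<le> \<delta>" and h': "norm (x - \<theta>' *\<^sub>R \<phi> h') \<le> \<delta>"
  defines "s \<equiv> u / \<theta> + v / \<theta>'"
  shows "0 < s" "1 / s \<le> u * \<theta> + v * \<theta>'"
    "norm (x - (1 / s) *\<^sub>R \<phi> (u *\<^sub>R h + v *\<^sub>R h')) \<le> \<delta>"
proof -
  have "0 < u \<or> 0 < v" using assms by linarith
  then show s: "0 < s"
    using assms by (auto simp: s_def add_pos_nonneg add_nonneg_pos)
  \<comment> \<open>Convexity of the inverse, applied at \<open>1 / \<theta>\<close> and
    \<open>1 / \<theta>'\<close>: the weighted harmonic mean is at most the arithmetic one.\<close>
  have "\<forall>a\<in>{0<..}. \<forall>b\<in>{0<..}. inverse (u *\<^sub>R a + v *\<^sub>R b) \<le> u * inverse a + v * inverse (b::real)"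
    using assms(2-4) convex_on_inverse[of "{0<..}"] unfolding convex_on_def by auto
  then have "inverse (u *\<^sub>R inverse \<theta> + v *\<^sub>R inverse \<theta>') \<le> u * inverse (inverse \<theta>) + v * inverse (inverse \<theta>')"
    using assms(5,6) by (metis greaterThan_iff inverse_positive_iff_positive)
  then show "1 / s \<le> u * \<theta> + v * \<theta>'" by (simp add: s_def divide_inverse)
  \<comment> \<open>The new residual is a convex combination of the two old ones, with weights
    \<open>u / (\<theta> * s)\<close> and \<open>v / (\<theta>' * s)\<close>.\<close>
  have "x - (1 / s) *\<^sub>R \<phi> (u *\<^sub>R h + v *\<^sub>R h')
      = (1 / s) *\<^sub>R ((u / \<theta>) *\<^sub>R (x - \<theta> *\<^sub>R \<phi> h) + (v / \<theta>') *\<^sub>R (x - \<theta>' *\<^sub>R \<phi> h'))"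
  proof -
    have "(u / \<theta>) *\<^sub>R (x - \<theta> *\<^sub>R \<phi> h) + (v / \<theta>') *\<^sub>R (x - \<theta>' *\<^sub>R \<phi> h')
        = s *\<^sub>R x - \<phi> (u *\<^sub>R h + v *\<^sub>R h')"
      using assms by (simp add: linear_add linear_scale s_def algebra_simps)
    then show ?thesis using s by (simp add: scaleR_diff_right)
  qed
  also have "norm \<dots> \<le> (1 / s) * (u / \<theta> * \<delta> + v / \<theta>' * \<delta>)"
    unfolding norm_scaleR using s assms(2,3,5,6) h h'
    by (auto intro!: mult_left_mono order_trans[OF norm_triangle_ineq] add_mono divide_right_mono)
  also have "\<dots> = \<delta>" using s unfolding s_def distrib_right[symmetric] by simp
  finally show "norm (x - (1 / s) *\<^sub>R \<phi> (u *\<^sub>R h + v *\<^sub>R h')) \<le> \<delta>" .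
qed

lemma convex_K_set:
  fixes \<phi> :: "'h::real_vector \<Rightarrow> 'v::real_inner"
  assumes "linear \<phi>" "0 \<le> \<delta>" "\<delta> < norm x"
  shows "convex (K_set \<phi> x \<delta>)"
proof (rule convexI)
  fix h h' and u v :: real
  assume h: "h \<in> K_set \<phi> x \<delta>" and h': "h' \<in> K_set \<phi> x \<delta>"
    and uv: "0 \<le> u" "0 \<le> v" "u + v = 1"
  obtain \<theta> \<theta>' where t: "0 < \<theta>" "0 < \<theta>'" "norm (x - \<theta> *\<^sub>R \<phi> h) \<le> \<delta>" "norm (x - \<theta>' *\<^sub>R \<phi> h') \<le> \<delta>"
    using K_setE[OF h] K_setE[OF h'] assms(2) by metis
  show "u *\<^sub>R h + v *\<^sub>R h' \<in> K_set \<phi> x \<delta>"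
    using scaling_combination(1,3)[OF assms(1) uv t] assms(3)
    by (intro K_setI[of "1 / (u / \<theta> + v / \<theta>')"]) simp_all
qed

text \<open>The scalings \<open>eta h\<close> and \<open>eta h'\<close> are feasible, so
  \<open>scaling_combination\<close> yields a feasible scaling for the combined point that is at
  most the average. Minimality of \<open>eta\<close> there finishes the argument.\<close>

lemma convex_on_eta:
  fixes \<phi> :: "'h::real_vector \<Rightarrow> 'v::real_inner"
  assumes "linear \<phi>" "0 \<le> \<epsilon>" "\<epsilon> < norm x"
  shows "convex_on (K_set \<phi> x \<epsilon>) (eta \<phi> x \<epsilon>)"
  unfolding convex_on_def
proof (intro conjI ballI allI impI)
  show K: "convex (K_set \<phi> x \<epsilon>)" using assms by (rule convex_K_set)
  fix h h' and u v :: real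
  assume h: "h \<in> K_set \<phi> x \<epsilon>" and h': "h' \<in> K_set \<phi> x \<epsilon>"
    and uv: "0 \<le> u" "0 \<le> v" "u + v = 1"
  note comb = scaling_combination[OF assms(1) uv eta_pos[OF h assms(2,3)] eta_pos[OF h' assms(2,3)]
      eta_feasible[OF h assms(2,3)] eta_feasible[OF h' assms(2,3)]]
  show "eta \<phi> x \<epsilon> (u *\<^sub>R h + v *\<^sub>R h') \<le> u * eta \<phi> x \<epsilon> h + v * eta \<phi> x \<epsilon> h'"
    using eta_le[OF convexD[OF K h h' uv] assms(2,3) comb(3)] comb(2) by linarith
qed

lemma H_set_eq:
  "H_set c \<phi> x \<epsilon> \<delta> M = cost_ball c \<inter> {h \<in> K_set \<phi> x \<delta>. eta \<phi> x \<epsilon> h \<le> M}"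
  by (auto simp: H_set_def)

text \<open>The feasible set intersects the cost ball with a sublevel set of the convex function
  \<open>eta\<close>, restricted to the smaller convex set
  \<open>K_set \<phi> x \<delta>\<close>.\<close>

lemma
  fixes \<phi> :: "'h::real_vector \<Rightarrow> 'v::real_inner"
  assumes "linear \<phi>" "convex (cost_ball c)" "0 \<le> \<delta>" "\<delta> \<le> \<epsilon>" "\<epsilon> < norm x"
  shows convex_H_set: "convex (H_set c \<phi> x \<epsilon> \<delta> M)"
    and convex_on_eta_H_set: "convex_on (H_set c \<phi> x \<epsilon> \<delta> M) (eta \<phi> x \<epsilon>)"
proof -
  have K: "convex (K_set \<phi> x \<delta>)" using assms by (intro convex_K_set) auto
  have sub: "K_set \<phi> x \<delta> \<subseteq> K_set \<phi> x \<epsilon>" using K_set_mono[OF _ assms(3,4)] by (rule subsetI)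
  have on: "convex_on (K_set \<phi> x \<delta>) (eta \<phi> x \<epsilon>)"
    using convex_on_subset[OF convex_on_eta[OF assms(1) _ assms(5)] sub K] assms(3,4) by simp
  have "convex {h \<in> K_set \<phi> x \<delta>. eta \<phi> x \<epsilon> h \<le> M}"
  proof (intro convexI CollectI conjI)
    fix h h' and u v :: real
    assume h: "h \<in> {h \<in> K_set \<phi> x \<delta>. eta \<phi> x \<epsilon> h \<le> M}" "h' \<in> {h \<in> K_set \<phi> x \<delta>. eta \<phi> x \<epsilon> h \<le> M}"
      and uv: "0 \<le> u" "0 \<le> v" "u + v = 1"
    show "u *\<^sub>R h + v *\<^sub>R h' \<in> K_set \<phi> x \<delta>" using h uv by (intro convexD[OF K]) auto
    have "eta \<phi> x \<epsilon> (u *\<^sub>R h + v *\<^sub>R h') \<le> u * eta \<phi> x \<epsilon> h + v * eta \<phi> x \<epsilon> h'"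
      using on h uv unfolding convex_on_def by blast
    also have "\<dots> \<le> M" using h uv by (intro convex_bound_le) auto
    finally show "eta \<phi> x \<epsilon> (u *\<^sub>R h + v *\<^sub>R h') \<le> M" .
  qed
  then show H: "convex (H_set c \<phi> x \<epsilon> \<delta> M)"
    unfolding H_set_eq using assms(2) convex_Int by blast
  show "convex_on (H_set c \<phi> x \<epsilon> \<delta> M) (eta \<phi> x \<epsilon>)"
    by (rule convex_on_subset[OF on _ H]) (auto simp: H_set_eq)
qed

section \<open>Smoothness\<close>

lemma lipschitz_on_bounded_image:
  fixes f :: "'a::metric_space \<Rightarrow> 'b::real_normed_vector"
  assumes "L-lipschitz_on S f" "bounded S"
  shows "\<exists>B\<ge>0. \<forall>h\<in>S. norm (f h) \<le> B"
proof -
  have L: "0 \<le> L" using assms(1) by (rule lipschitz_on_nonneg)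
  show ?thesis
  proof (cases "S = {}")
    case False
    then obtain k where k: "k \<in> S" by blast
    obtain e where e: "\<And>h. h \<in> S \<Longrightarrow> dist k h \<le> e" using assms(2) bounded_any_center by metis
    have "norm (f h) \<le> norm (f k) + L * e" if "h \<in> S" for h
    proof -
      have "norm (f h) \<le> norm (f k) + dist (f k) (f h)"
        unfolding dist_norm by (metis norm_minus_commute norm_triangle_sub)
      also have "dist (f k) (f h) \<le> L * e"
        using lipschitz_onD[OF assms(1) k that] mult_left_mono[OF e[OF that] L] by linarith
      finally show ?thesis by simp
    qed
    moreover from this[OF k] have "0 \<le> norm (f k) + L * e" by (rule order_trans[OF norm_ge_zero])
    ultimately show ?thesis by blast
  qed auto
qed

text \<open>A product rule needs bounded factors, which the bounded domain supplies. Constants stay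
  existentially quantified here and below, so that the rules chain by \<open>intro\<close> without
  tracking values.\<close>

lemma lipschitz_on_scaleR_bounded:
  fixes f :: "'a::metric_space \<Rightarrow> real" and g :: "'a \<Rightarrow> 'b::real_normed_vector"
  assumes "bounded S" and f: "\<exists>L. L-lipschitz_on S f" and g: "\<exists>L. L-lipschitz_on S g"
  shows "\<exists>L. L-lipschitz_on S (\<lambda>h. f h *\<^sub>R g h)"
proof -
  obtain L where L: "L-lipschitz_on S f" using f by blast
  obtain K where K: "K-lipschitz_on S g" using g by blast
  obtain A where A: "A \<ge> 0" "\<And>h. h \<in> S \<Longrightarrow> \<bar>f h\<bar> \<le> A"
    using lipschitz_on_bounded_image[OF L assms(1)] by auto
  obtain B where B: "B \<ge> 0" "\<And>h. h \<in> S \<Longrightarrow> norm (g h) \<le> B"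
    using lipschitz_on_bounded_image[OF K assms(1)] by auto
  have LK: "0 \<le> L" "0 \<le> K" using L K lipschitz_on_nonneg by blast+
  have "(A * K + L * B)-lipschitz_on S (\<lambda>h. f h *\<^sub>R g h)"
  proof (rule lipschitz_onI)
    fix h k assume hk: "h \<in> S" "k \<in> S"
    have "f h *\<^sub>R g h - f k *\<^sub>R g k = f h *\<^sub>R (g h - g k) + (f h - f k) *\<^sub>R g k"
      by (simp add: algebra_simps)
    then have "dist (f h *\<^sub>R g h) (f k *\<^sub>R g k) \<le> \<bar>f h\<bar> * dist (g h) (g k) + dist (f h) (f k) * norm (g k)"
      unfolding dist_norm using norm_triangle_ineq[of "f h *\<^sub>R (g h - g k)" "(f h - f k) *\<^sub>R g k"] by simp
    also have "\<dots> \<le> A * (K * dist h k) + (L * dist h k) * B"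
      using hk A B LK lipschitz_onD[OF L] lipschitz_onD[OF K] by (intro add_mono mult_mono) auto
    finally show "dist (f h *\<^sub>R g h) (f k *\<^sub>R g k) \<le> (A * K + L * B) * dist h k"
      by (simp add: algebra_simps)
  qed (use A B LK in simp)
  then show ?thesis by blast
qed

lemma lipschitz_on_mult_bounded:
  fixes f g :: "'a::metric_space \<Rightarrow> real"
  assumes "bounded S" "\<exists>L. L-lipschitz_on S f" "\<exists>L. L-lipschitz_on S g"
  shows "\<exists>L. L-lipschitz_on S (\<lambda>h. f h * g h)"
  using lipschitz_on_scaleR_bounded[OF assms] unfolding real_scaleR_def .

lemma ex_lipschitz_on_add:
  fixes f g :: "'a::metric_space \<Rightarrow> 'b::real_normed_vector"
  assumes "\<exists>L. L-lipschitz_on S f" "\<exists>L. L-lipschitz_on S g"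
  shows "\<exists>L. L-lipschitz_on S (\<lambda>h. f h + g h)"
  using assms by (elim exE) (rule exI, rule lipschitz_on_add)

lemma ex_lipschitz_on_diff:
  fixes f g :: "'a::metric_space \<Rightarrow> 'b::real_normed_vector"
  assumes "\<exists>L. L-lipschitz_on S f" "\<exists>L. L-lipschitz_on S g"
  shows "\<exists>L. L-lipschitz_on S (\<lambda>h. f h - g h)"
  using assms by (elim exE) (rule exI, rule lipschitz_on_diff)

lemma ex_lipschitz_on_const: "\<exists>L. L-lipschitz_on S (\<lambda>h. k)"
  by (rule exI, rule lipschitz_on_constant)

lemma ex_lipschitz_on_linear:
  fixes f :: "'a::euclidean_space \<Rightarrow> 'b::real_normed_vector"
  assumes "linear f"
  shows "\<exists>L. L-lipschitz_on S f"
proof -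
  have "bounded_linear f" using assms by (simp add: linear_conv_bounded_linear)
  then obtain L where "L-lipschitz_on S f" by (rule bounded_linear.lipschitz_boundE)
  then show ?thesis by (rule exI)
qed

lemma ex_lipschitz_on_inverse:
  fixes f :: "'a::metric_space \<Rightarrow> real"
  assumes "\<exists>L. L-lipschitz_on S f" "0 < m" "\<And>h. h \<in> S \<Longrightarrow> m \<le> f h"
  shows "\<exists>L. L-lipschitz_on S (\<lambda>h. inverse (f h))"
proof -
  obtain L where L: "L-lipschitz_on S f" using assms by blast
  have "(L / m\<^sup>2)-lipschitz_on S (\<lambda>h. inverse (f h))"
  proof (rule lipschitz_onI)
    fix h k assume hk: "h \<in> S" "k \<in> S"
    then have fm: "m \<le> f h" "m \<le> f k" using assms(3) by auto
    then have pos: "0 < f h" "0 < f k" "m\<^sup>2 \<le> f h * f k"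
      using \<open>0 < m\<close> by (auto simp: power2_eq_square intro: mult_mono)
    have "inverse (f h) - inverse (f k) = (f k - f h) / (f h * f k)"
      using pos by (simp add: field_simps)
    then have "dist (inverse (f h)) (inverse (f k)) = dist (f h) (f k) / (f h * f k)"
      using pos by (simp add: dist_real_def abs_minus_commute abs_mult)
    also have "\<dots> \<le> (L * dist h k) / m\<^sup>2"
      using lipschitz_onD[OF L hk] lipschitz_on_nonneg[OF L] pos \<open>0 < m\<close> by (intro frac_le) auto
    finally show "dist (inverse (f h)) (inverse (f k)) \<le> L / m\<^sup>2 * dist h k" by simp
  qed (use lipschitz_on_nonneg[OF L] in simp)
  then show ?thesis by blast
qed

text \<open>The difference of the roots is the difference of the values divided by the sum of the
  roots, and that sum is at least \<open>sqrt m\<close>.\<close>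

lemma ex_lipschitz_on_sqrt:
  fixes f :: "'a::metric_space \<Rightarrow> real"
  assumes "\<exists>L. L-lipschitz_on S f" "0 < m" "\<And>h. h \<in> S \<Longrightarrow> m \<le> f h"
  shows "\<exists>L. L-lipschitz_on S (\<lambda>h. sqrt (f h))"
proof -
  obtain L where L: "L-lipschitz_on S f" using assms by blast
  have "(L / sqrt m)-lipschitz_on S (\<lambda>h. sqrt (f h))"
  proof (rule lipschitz_onI)
    fix h k assume hk: "h \<in> S" "k \<in> S"
    then have fm: "m \<le> f h" "m \<le> f k" using assms(3) by auto
    then have pos: "0 < sqrt (f h)" "0 < sqrt (f k)" "sqrt m \<le> sqrt (f h)"
      using \<open>0 < m\<close> by auto
    have "(sqrt (f h) - sqrt (f k)) * (sqrt (f h) + sqrt (f k)) = f h - f k"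
      using fm \<open>0 < m\<close> by (simp add: algebra_simps)
    then have "\<bar>sqrt (f h) - sqrt (f k)\<bar> * (sqrt (f h) + sqrt (f k)) = \<bar>f h - f k\<bar>"
      using pos by (metis abs_mult abs_of_pos add_pos_pos)
    then have "dist (sqrt (f h)) (sqrt (f k)) = dist (f h) (f k) / (sqrt (f h) + sqrt (f k))"
      using add_pos_pos[OF pos(1,2)] by (simp only: dist_real_def eq_divide_eq) simp
    also have "\<dots> \<le> (L * dist h k) / sqrt m"
      using lipschitz_onD[OF L hk] lipschitz_on_nonneg[OF L] pos \<open>0 < m\<close>
      by (intro frac_le add_increasing2) auto
    finally show "dist (sqrt (f h)) (sqrt (f k)) \<le> L / sqrt m * dist h k" by simp
  qed (use lipschitz_on_nonneg[OF L] \<open>0 < m\<close> in simp)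
  then show ?thesis by blast
qed

text \<open>By \<open>eta_eq\<close>, \<open>eta\<close> is \<open>D / (a + sqrt r)\<close> with
  \<open>a\<close> linear and \<open>r\<close> quadratic. Once \<open>r\<close> and the denominator
  are bounded below, its gradient is built from Lipschitz functions on a bounded set.\<close>

lemma beta_smooth_on_eta:
  fixes \<phi> :: "'h::euclidean_space \<Rightarrow> 'v::euclidean_space"
  assumes lin: "linear \<phi>" and bdd: "bounded (cost_ball c)"
    and "0 \<le> \<delta>" "\<delta> < \<epsilon>" "\<epsilon> < norm x" "0 < M"
  shows "\<exists>\<beta>\<ge>0. beta_smooth_on \<beta> (eta \<phi> x \<epsilon>) (H_set c \<phi> x \<epsilon> \<delta> M)"
proof -
  define S where "S = H_set c \<phi> x \<epsilon> \<delta> M"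
  define D where "D = (norm x)\<^sup>2 - \<epsilon>\<^sup>2"
  define E where "E = (norm x)\<^sup>2 - \<delta>\<^sup>2"
  \<comment> \<open>The adjoint represents \<phi> by vectors of the domain:
    \<open>a h = x \<bullet> \<phi> h\<close> has gradient \<open>p\<close>, and
    \<open>T h \<bullet> h = (norm (\<phi> h))\<^sup>2\<close> has gradient
    \<open>2 *\<^sub>R T h\<close>.\<close>
  define p where "p = adjoint \<phi> x"
  define T where "T h = adjoint \<phi> (\<phi> h)" for h
  define a where "a h = p \<bullet> h" for h
  define r where "r h = a h * a h - D * (T h \<bullet> h)" for h
  define g where "g h = a h + sqrt (r h)" for h
  have adj: "adjoint \<phi> y \<bullet> h = y \<bullet> \<phi> h" for y h
    by (rule adjoint_clauses[OF lin])
  have r_alt: "r h = (x \<bullet> \<phi> h)\<^sup>2 - D * (norm (\<phi> h))\<^sup>2" for h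
    by (simp add: r_def a_def p_def T_def adj power2_norm_eq_inner) (simp add: power2_eq_square)
  have eta: "eta \<phi> x \<epsilon> = (\<lambda>h. D / g h)"
    by (rule ext) (simp add: eta_eq D_def g_def r_alt a_def p_def adj)
  have D: "0 < D" using assms by (simp add: D_def power_strict_mono)
  have DE: "D < E" using assms by (simp add: D_def E_def power_strict_mono)
  have linT: "linear T"
    using linear_compose[OF lin adjoint_linear[OF lin]] by (simp add: T_def[abs_def] o_def)

  \<comment> \<open>\<open>a0\<close> comes from \<open>D / g h \<le> M\<close> and
    \<open>g h \<le> 2 * a h\<close>. \<open>r0\<close> comes from
    \<open>r h \<ge> (a h)\<^sup>2 * (1 - D / E)\<close>, a consequence of
    \<open>K_set_discriminant\<close>; it is positive since \<delta> < \<epsilon> gives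
    \<open>D < E\<close>.\<close>
  define a0 where "a0 = D / (2 * M)"
  define r0 where "r0 = a0\<^sup>2 * (1 - D / E)"
  have a0: "0 < a0" using D \<open>0 < M\<close> by (simp add: a0_def)
  have r0: "0 < r0" using a0 D DE by (simp add: r0_def)
  have bounds: "a0 \<le> a h \<and> r0 \<le> r h" if "h \<in> S" for h
  proof -
    have K: "h \<in> K_set \<phi> x \<delta>" and M: "D / g h \<le> M"
      using that by (auto simp: S_def H_set_def eta)
    have a: "0 < a h" using K by (simp add: K_set_def a_def p_def adj)
    have disc: "E * (norm (\<phi> h))\<^sup>2 \<le> (a h)\<^sup>2"
      using K_set_discriminant[OF K] by (simp add: E_def a_def p_def adj)
    have r_ge: "(a h)\<^sup>2 * (1 - D / E) \<le> r h"
    proof -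
      have "(norm (\<phi> h))\<^sup>2 \<le> (a h)\<^sup>2 / E" using disc D DE by (simp add: field_simps)
      then have "D * (norm (\<phi> h))\<^sup>2 \<le> D * ((a h)\<^sup>2 / E)" using D by (intro mult_left_mono) simp_all
      then show ?thesis unfolding r_alt by (simp add: a_def p_def adj algebra_simps)
    qed
    have "0 < (a h)\<^sup>2 * (1 - D / E)" using a D DE by simp
    then have "0 < r h" using r_ge by linarith
    have "r h \<le> (a h)\<^sup>2" unfolding r_alt using D by (simp add: a_def p_def adj)
    then have "sqrt (r h) \<le> a h" using a real_le_lsqrt by (simp add: real_le_lsqrt)
    then have "0 < g h" "g h \<le> 2 * a h" using a \<open>0 < r h\<close> by (simp_all add: g_def add_pos_pos)
    then have "D \<le> M * (2 * a h)"
      using M \<open>0 < M\<close> by (smt (verit) mult_left_mono pos_divide_le_eq)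
    then have a0_le: "a0 \<le> a h" using \<open>0 < M\<close> by (simp add: a0_def field_simps)
    then have "a0\<^sup>2 \<le> (a h)\<^sup>2" using a0 by (simp add: power_mono)
    then have "r0 \<le> (a h)\<^sup>2 * (1 - D / E)"
      unfolding r0_def using D DE by (intro mult_right_mono) auto
    then show ?thesis using r_ge a0_le by simp
  qed
  have g_ge: "a0 \<le> g h" if "h \<in> S" for h
    using bounds[OF that] r0 by (simp add: g_def add_increasing2)

  \<comment> \<open>The chain rule for \<open>D / g\<close>, with
    \<open>(2 * a h) *\<^sub>R p - (2 * D) *\<^sub>R T h\<close> as the gradient of
    \<open>r\<close>.\<close>
  define G where "G h = (- D * (inverse (g h) * inverse (g h))) *\<^sub>R
      (p + (inverse (sqrt (r h)) * (1/2)) *\<^sub>R ((2 * a h) *\<^sub>R p - (2 * D) *\<^sub>R T h))" for h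
  have GD: "GDERIV (eta \<phi> x \<epsilon>) h :> G h" if "h \<in> S" for h
  proof -
    have rh: "0 < r h" and gh: "0 < g h" using bounds[OF that] g_ge[OF that] r0 a0 by auto
    have da: "GDERIV a h :> p"
      unfolding gderiv_def a_def by (auto intro!: derivative_eq_intros simp: inner_commute)
    have "bounded_linear T" using linT by (simp add: linear_conv_bounded_linear)
    then have "((\<lambda>k. T k \<bullet> k) has_derivative (\<lambda>k. T h \<bullet> k + T k \<bullet> h)) (at h)"
      by (intro has_derivative_inner bounded_linear_imp_has_derivative has_derivative_ident)
    \<comment> \<open>\<open>T\<close> is self-adjoint, so the two terms of the product rule
      coincide.\<close>
    moreover have "T h \<bullet> k + T k \<bullet> h = k \<bullet> (2 *\<^sub>R T h)" for k
      using adj[of "\<phi> h" k] adj[of "\<phi> k" h]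
      by (simp add: T_def inner_commute[of k] inner_commute[of "\<phi> k"])
    ultimately have dT: "GDERIV (\<lambda>k. T k \<bullet> k) h :> 2 *\<^sub>R T h" by (simp add: gderiv_def)
    have dr: "GDERIV r h :> (2 * a h) *\<^sub>R p - (2 * D) *\<^sub>R T h"
      unfolding r_def
      by (rule GDERIV_subst[OF GDERIV_diff[OF GDERIV_mult[OF da da] GDERIV_mult[OF GDERIV_const dT]]])
        (simp add: algebra_simps flip: scaleR_add_left)
    have ds: "GDERIV (\<lambda>k. sqrt (r k)) h :> (inverse (sqrt (r h)) * (1/2)) *\<^sub>R ((2 * a h) *\<^sub>R p - (2 * D) *\<^sub>R T h)"
      using GDERIV_DERIV_compose[OF dr DERIV_real_sqrt[OF rh]] by simp
    have "GDERIV g h :> p + (inverse (sqrt (r h)) * (1/2)) *\<^sub>R ((2 * a h) *\<^sub>R p - (2 * D) *\<^sub>R T h)"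
      unfolding g_def by (rule GDERIV_add[OF da ds])
    moreover have "DERIV (\<lambda>y. D / y) (g h) :> - D * (inverse (g h) * inverse (g h))"
      using gh by (auto intro!: derivative_eq_intros simp: field_simps)
    ultimately show ?thesis unfolding eta G_def by (rule GDERIV_DERIV_compose)
  qed

  have bS: "bounded S" unfolding S_def by (rule bounded_subset[OF bdd]) (auto simp: H_set_def)
  have La: "\<exists>L. L-lipschitz_on S a"
    unfolding a_def by (intro ex_lipschitz_on_linear) (auto intro!: linearI simp: inner_add_right)
  have LT: "\<exists>L. L-lipschitz_on S T" by (rule ex_lipschitz_on_linear[OF linT])
  \<comment> \<open>In coordinates the quadratic form is a finite sum of products of real linear
    functions, so the product rule applies.\<close>
  have r_sq: "T h \<bullet> h = (\<Sum>b\<in>Basis. (T h \<bullet> b) * (h \<bullet> b))" for h by (rule euclidean_inner)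
  have Li: "\<exists>L. L-lipschitz_on S (\<lambda>h. T h \<bullet> h)"
  proof -
    have "\<exists>L. L-lipschitz_on S (\<lambda>h. \<Sum>b\<in>B. (T h \<bullet> b) * (h \<bullet> b))" if "finite B" for B
      using that
    proof (induction B)
      case empty
      show ?case by (simp add: ex_lipschitz_on_const)
    next
      case (insert b B)
      have "\<exists>L. L-lipschitz_on S (\<lambda>h. (T h \<bullet> b) * (h \<bullet> b))"
        by (intro lipschitz_on_mult_bounded[OF bS] ex_lipschitz_on_linear)
          (auto intro!: linearI simp: inner_add_left linear_add[OF linT] linear_scale[OF linT])
      then show ?case using insert ex_lipschitz_on_add by simp
    qed
    then show ?thesis unfolding r_sq by simp
  qed
  have Lr: "\<exists>L. L-lipschitz_on S r" unfolding r_def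
    by (intro ex_lipschitz_on_diff lipschitz_on_mult_bounded[OF bS] ex_lipschitz_on_const La Li)
  have Lsq: "\<exists>L. L-lipschitz_on S (\<lambda>h. sqrt (r h))"
    using bounds by (intro ex_lipschitz_on_sqrt[OF Lr r0]) auto
  have Lg: "\<exists>L. L-lipschitz_on S g" unfolding g_def by (intro ex_lipschitz_on_add La Lsq)
  have Lig: "\<exists>L. L-lipschitz_on S (\<lambda>h. inverse (g h))"
    using g_ge by (intro ex_lipschitz_on_inverse[OF Lg a0])
  have Lis: "\<exists>L. L-lipschitz_on S (\<lambda>h. inverse (sqrt (r h)))"
    using bounds r0 by (intro ex_lipschitz_on_inverse[OF Lsq, of "sqrt r0"]) auto
  have "\<exists>L. L-lipschitz_on S G" unfolding G_def
    by (intro ex_lipschitz_on_add ex_lipschitz_on_diff lipschitz_on_scaleR_bounded[OF bS]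
        lipschitz_on_mult_bounded[OF bS] ex_lipschitz_on_const La LT Lig Lis)
  then obtain L where L: "L-lipschitz_on S G" by blast
  have "beta_smooth_on L (eta \<phi> x \<epsilon>) S"
    unfolding beta_smooth_on_def by (intro exI[of _ G] conjI ballI GD lipschitz_on_normD[OF L])
  with lipschitz_on_nonneg[OF L] have "0 \<le> L \<and> beta_smooth_on L (eta \<phi> x \<epsilon>) S" by (rule conjI)
  then show ?thesis unfolding S_def by (rule exI[of _ L])
qed

section \<open>Optimal solutions of the linear inverse problem\<close>

lemma solution_of_iff: "solution_of f S s \<longleftrightarrow> s \<in> S \<and> (\<forall>t\<in>S. f s \<le> f t)"
  by (auto simp: solution_of_def is_arg_min_linorder)

lemma optimal_value_eq:
  assumes "solution_of f S s"
  shows "optimal_value f S = f s"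
  unfolding optimal_value_def using assms
  by (intro cInf_eq_minimum) (auto simp: solution_of_iff)

lemma lip_feasible_nonzero:
  assumes "linear \<phi>" "f \<in> lip_feasible \<phi> x \<epsilon>" "\<epsilon> < norm x"
  shows "f \<noteq> 0"
  using assms linear_0[OF assms(1)] by (auto simp: lip_feasible_def)

text \<open>For small \<open>t\<close> the negative linear term dominates the quadratic one; the
  middle condition keeps the coefficient \<open>1 - t * K\<close> positive.\<close>

lemma small_step:
  fixes A B K :: real
  assumes "A < 0"
  obtains t where "0 < t" "t * K < 1" "t * A + t\<^sup>2 * B < 0"
proof -
  have "0 < min (1 / (\<bar>K\<bar> + 1)) (- A / (\<bar>B\<bar> + 1))"
    using assms by (simp add: add_nonneg_pos divide_neg_pos)
  then obtain t where t: "0 < t" "t < 1 / (\<bar>K\<bar> + 1)" "t < - A / (\<bar>B\<bar> + 1)"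
    using dense[of 0] by (metis min_less_iff_conj)
  have "t * (\<bar>K\<bar> + 1) < 1" "t * (\<bar>B\<bar> + 1) < - A"
    using t(2,3) by (simp_all only: pos_less_divide_eq abs_add_one_gt_zero add.commute[of _ 1])
  moreover have "t * K \<le> t * (\<bar>K\<bar> + 1)" "t * B \<le> t * (\<bar>B\<bar> + 1)"
    using t(1) by (simp_all add: mult_left_mono)
  ultimately have "t * K < 1" "A + t * B < 0" by linarith+
  then have "t * (A + t * B) < 0" using t(1) by (simp add: mult_pos_neg)
  then have "t * A + t\<^sup>2 * B < 0" by (simp add: algebra_simps power2_eq_square)
  with t(1) \<open>t * K < 1\<close> show thesis by (rule that)
qed

text \<open>Slack in the constraint would allow \<open>f\<close> to be shrunk slightly while staying
  feasible, which lowers its positive cost.\<close>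

lemma solution_residual:
  fixes c :: "'h::real_normed_vector \<Rightarrow> real" and \<phi> :: "'h \<Rightarrow> 'v::real_inner"
  assumes lin: "linear \<phi>" and hom: "positively_homogeneous c" and bdd: "bounded (cost_ball c)"
    and eps: "\<epsilon> < norm x" and sol: "solution_of c (lip_feasible \<phi> x \<epsilon>) f"
  shows "norm (x - \<phi> f) = \<epsilon>"
proof (rule ccontr)
  assume "norm (x - \<phi> f) \<noteq> \<epsilon>"
  then have less: "norm (x - \<phi> f) < \<epsilon>"
    using sol by (auto simp: solution_of_iff lip_feasible_def)
  have cpos: "0 < c f"
    using cost_pos[OF hom bdd] lip_feasible_nonzero[OF lin _ eps] sol by (auto simp: solution_of_iff)
  \<comment> \<open>The relative shrinkage that the slack pays for; the added 1 avoids division by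
    zero when \<open>\<phi> f = 0\<close>.\<close>
  define d where "d = (\<epsilon> - norm (x - \<phi> f)) / (norm (\<phi> f) + 1)"
  define t where "t = min 1 d"
  have d: "0 < d" using less by (simp add: d_def add_nonneg_pos)
  have t: "0 < t" "t \<le> 1" "t \<le> d" using d by (auto simp: t_def)
  have "t * norm (\<phi> f) \<le> d * (norm (\<phi> f) + 1)" using t d by (intro mult_mono) auto
  also have "\<dots> = \<epsilon> - norm (x - \<phi> f)"
    using norm_ge_zero[of "\<phi> f"] by (simp add: d_def add_nonneg_eq_0_iff)
  finally have tn: "t * norm (\<phi> f) \<le> \<epsilon> - norm (x - \<phi> f)" .
  have "x - \<phi> ((1 - t) *\<^sub>R f) = (x - \<phi> f) + t *\<^sub>R \<phi> f"
    using lin by (simp add: linear_scale linear_diff algebra_simps)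
  then have "norm (x - \<phi> ((1 - t) *\<^sub>R f)) \<le> norm (x - \<phi> f) + t * norm (\<phi> f)"
    using norm_triangle_ineq[of "x - \<phi> f" "t *\<^sub>R \<phi> f"] t(1)
    by (simp only: norm_scaleR abs_of_pos)
  then have "(1 - t) *\<^sub>R f \<in> lip_feasible \<phi> x \<epsilon>" using tn by (simp add: lip_feasible_def)
  then have "c f \<le> (1 - t) * c f"
    using sol cost_scale[OF hom, of "1 - t" f] t by (auto simp: solution_of_iff)
  then have "t * c f \<le> 0" by (simp add: algebra_simps)
  then show False using mult_pos_pos[OF t(1) cpos] by linarith
qed

text \<open>If \<open>err \<phi> x f = \<epsilon>\<^sup>2\<close>, the residual is orthogonal to \<open>\<phi> f\<close>. Shrinking \<open>f\<close> is then
  free to first order, and mixing in a Slater point strictly reduces the residual, which gives a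
  feasible point of smaller cost.\<close>
lemma solution_err_less:
  fixes c :: "'h::real_normed_vector \<Rightarrow> real" and \<phi> :: "'h \<Rightarrow> 'v::real_inner"
  assumes lin: "linear \<phi>" and hom: "positively_homogeneous c" and bdd: "bounded (cost_ball c)"
    and conv: "convex (cost_ball c)" and eps: "\<epsilon> < norm x" "0 < \<epsilon>"
    and slater: "norm (x - \<phi> f\<^sub>0) < \<epsilon>" and sol: "solution_of c (lip_feasible \<phi> x \<epsilon>) f"
  shows "err \<phi> x f < \<epsilon>\<^sup>2"
proof (rule ccontr)
  assume "\<not> err \<phi> x f < \<epsilon>\<^sup>2"
  define u where "u = x - \<phi> f"
  have nu: "norm u = \<epsilon>" using solution_residual[OF lin hom bdd eps(1) sol] by (simp add: u_def)
  have min: "\<epsilon>\<^sup>2 \<le> (norm (u + s *\<^sub>R \<phi> f))\<^sup>2" for s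
  proof -
    have "x - (1 - s) *\<^sub>R \<phi> f = u + s *\<^sub>R \<phi> f" by (simp add: u_def algebra_simps)
    then show ?thesis using err_le[of \<phi> x f "1 - s"] \<open>\<not> err \<phi> x f < \<epsilon>\<^sup>2\<close> by simp
  qed
  have orth: "u \<bullet> \<phi> f = 0"
  proof (cases "\<phi> f = 0")
    case False
    \<comment> \<open>Minimality at the least-squares step along \<open>\<phi> f\<close>: the
      decrease \<open>(u \<bullet> \<phi> f)\<^sup>2 / (norm (\<phi> f))\<^sup>2\<close> must
      vanish.\<close>
    have "0 \<le> (norm u)\<^sup>2 - \<bar>u \<bullet> \<phi> f\<bar>\<^sup>2 / (norm (\<phi> f))\<^sup>2 - (norm u)\<^sup>2"
      using min[of "- (u \<bullet> \<phi> f / (norm (\<phi> f))\<^sup>2)"] err_aux(2)[of u "\<phi> f"] False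
      by (simp add: nu)
    then show ?thesis using False by (simp add: divide_le_0_iff)
  qed simp
  have "u \<bullet> (x - \<phi> f\<^sub>0) \<le> \<epsilon> * norm (x - \<phi> f\<^sub>0)"
    using norm_cauchy_schwarz[of u "x - \<phi> f\<^sub>0"] nu by simp
  also have "\<dots> < \<epsilon> * \<epsilon>" using slater eps by simp
  also have "\<epsilon> * \<epsilon> = u \<bullet> x"
  proof -
    have "u \<bullet> x = u \<bullet> u + u \<bullet> \<phi> f" by (simp add: u_def inner_diff_right)
    then show ?thesis using orth nu by (simp add: dot_square_norm power2_eq_square)
  qed
  finally have upos: "0 < u \<bullet> \<phi> f\<^sub>0" by (simp add: inner_diff_right)
  have cpos: "0 < c f"
    using cost_pos[OF hom bdd] lip_feasible_nonzero[OF lin _ eps(1)] sol by (auto simp: solution_of_iff)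
  \<comment> \<open>Chosen so that exchanging \<open>t * \<kappa>\<close> of \<open>f\<close> for
    \<open>t\<close> of \<open>f\<^sub>0\<close> lowers the cost. By orthogonality the removed part
    does not affect the residual to first order.\<close>
  define \<kappa> where "\<kappa> = (\<bar>c f\<^sub>0\<bar> + 1) / c f"
  have kc: "c f\<^sub>0 < \<kappa> * c f" using cpos by (auto simp: \<kappa>_def)
  define w where "w = \<kappa> *\<^sub>R \<phi> f - \<phi> f\<^sub>0"
  have uw: "2 * (u \<bullet> w) < 0" using upos orth by (simp add: w_def inner_diff_right)
  obtain t where t: "0 < t" "t * \<kappa> < 1" "t * (2 * (u \<bullet> w)) + t\<^sup>2 * (norm w)\<^sup>2 < 0"
    using small_step[OF uw] by blast
  define k where "k = (1 - t * \<kappa>) *\<^sub>R f + t *\<^sub>R f\<^sub>0"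
  have "x - \<phi> k = u - (- t) *\<^sub>R w"
    using lin by (simp add: k_def u_def w_def linear_add linear_diff linear_scale algebra_simps)
  then have "(norm (x - \<phi> k))\<^sup>2 = \<epsilon>\<^sup>2 + (t * (2 * (u \<bullet> w)) + t\<^sup>2 * (norm w)\<^sup>2)"
    using norm_diff_scaleR_squared[of u "- t" w] by (simp add: nu)
  then have "(norm (x - \<phi> k))\<^sup>2 \<le> \<epsilon>\<^sup>2" using t(3) by linarith
  then have "k \<in> lip_feasible \<phi> x \<epsilon>"
    using eps(2) power2_le_imp_le by (force simp: lip_feasible_def)
  then have "c f \<le> c k" using sol by (simp add: solution_of_iff)
  also have "c k \<le> (1 - t * \<kappa>) * c f + t * c f\<^sub>0"
    unfolding k_def using t by (intro cost_combination[OF hom bdd conv]) auto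
  finally have "t * (\<kappa> * c f) \<le> t * c f\<^sub>0" by (simp add: algebra_simps)
  then show False using t(1) kc by simp
qed

text \<open>Otherwise the midpoint of two solutions would have residual smaller than \<open>\<epsilon>\<close>.\<close>
lemma solution_image_unique:
  fixes c :: "'h::real_normed_vector \<Rightarrow> real" and \<phi> :: "'h \<Rightarrow> 'v::real_inner"
  assumes lin: "linear \<phi>" and hom: "positively_homogeneous c" and bdd: "bounded (cost_ball c)"
    and conv: "convex (cost_ball c)" and eps: "\<epsilon> < norm x"
    and f: "solution_of c (lip_feasible \<phi> x \<epsilon>) f" and g: "solution_of c (lip_feasible \<phi> x \<epsilon>) g"
  shows "\<phi> f = \<phi> g"
proof -
  define u v where "u = x - \<phi> f" and "v = x - \<phi> g"
  define k where "k = (1/2) *\<^sub>R f + (1/2) *\<^sub>R g"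
  note res = solution_residual[OF lin hom bdd eps]
  have uv: "norm u = \<epsilon>" "norm v = \<epsilon>" using res[OF f] res[OF g] by (simp_all add: u_def v_def)
  have mid: "x - \<phi> k = (1/2) *\<^sub>R (u + v)"
    using lin by (simp add: k_def u_def v_def linear_add linear_scale scaleR_add_right
        scaleR_diff_right flip: scaleR_add_left)
  then have "norm (x - \<phi> k) \<le> \<epsilon>" using norm_triangle_ineq[of u v] uv by simp
  then have "k \<in> lip_feasible \<phi> x \<epsilon>" by (simp add: lip_feasible_def)
  moreover have "c k \<le> c f"
    using cost_combination[OF hom bdd conv, of "1/2" "1/2" f g] f g
    by (force simp: k_def solution_of_iff)
  ultimately have "solution_of c (lip_feasible \<phi> x \<epsilon>) k"
    using f by (force simp: solution_of_iff)
  then have "norm (u + v) = 2 * \<epsilon>" using res mid by fastforce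
  \<comment> \<open>The parallelogram law: \<open>u\<close>, \<open>v\<close> and their midpoint all
    have norm \<epsilon>, which forces \<open>u = v\<close>.\<close>
  moreover have "(norm (u + v))\<^sup>2 + (norm (u - v))\<^sup>2 = 2 * (norm u)\<^sup>2 + 2 * (norm v)\<^sup>2"
    by (simp add: power2_norm_eq_inner inner_add_left inner_add_right inner_diff_left inner_diff_right)
  ultimately have "u - v = 0" using uv by (simp add: power2_eq_square)
  then show ?thesis by (simp add: u_def v_def)
qed

section \<open>Equivalence with the linear inverse problem\<close>

lemma err_scaleR:
  assumes "linear \<phi>" "r \<noteq> 0"
  shows "err \<phi> x (r *\<^sub>R h) = err \<phi> x h"
  using assms by (simp add: err_closed_form linear_scale abs_mult power_mult_distrib)

lemma lip_feasible_eta_scaleR: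
  fixes c :: "'h::real_normed_vector \<Rightarrow> real" and \<phi> :: "'h \<Rightarrow> 'v::real_inner"
  assumes lin: "linear \<phi>" and hom: "positively_homogeneous c"
    and "0 \<le> \<epsilon>" "\<epsilon> < norm x" "h \<in> K_set \<phi> x \<epsilon>" "c h \<le> 1"
  shows "eta \<phi> x \<epsilon> h *\<^sub>R h \<in> lip_feasible \<phi> x \<epsilon>" "c (eta \<phi> x \<epsilon> h *\<^sub>R h) \<le> eta \<phi> x \<epsilon> h"
proof -
  show "eta \<phi> x \<epsilon> h *\<^sub>R h \<in> lip_feasible \<phi> x \<epsilon>"
    using eta_feasible[OF assms(5,3,4)] lin by (simp add: lip_feasible_def linear_scale)
  show "c (eta \<phi> x \<epsilon> h *\<^sub>R h) \<le> eta \<phi> x \<epsilon> h"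
    using eta_pos[OF assms(5,3,4)] assms(6) by (simp add: cost_scale[OF hom])
qed

text \<open>Dividing an optimal solution by its cost \<open>m\<close> gives unit cost and leaves
  \<open>err\<close> unchanged; \<open>m\<close> itself is then a feasible scaling, hence an upper
  bound for \<open>eta\<close>.\<close>

lemma normalized_solution:
  fixes c :: "'h::real_normed_vector \<Rightarrow> real" and \<phi> :: "'h \<Rightarrow> 'v::real_inner"
  assumes lin: "linear \<phi>" and hom: "positively_homogeneous c"
    and "0 \<le> \<epsilon>" "\<epsilon> < norm x" "0 < m" "m \<le> M"
    and sol: "solution_of c (lip_feasible \<phi> x \<epsilon>) (m *\<^sub>R h)" "c (m *\<^sub>R h) = m"
    and err: "err \<phi> x (m *\<^sub>R h) \<le> \<delta>\<^sup>2"
  shows "h \<in> H_set c \<phi> x \<epsilon> \<delta> M" "eta \<phi> x \<epsilon> h \<le> m"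
proof -
  have feas: "norm (x - m *\<^sub>R \<phi> h) \<le> \<epsilon>"
    using sol lin by (simp add: solution_of_iff lip_feasible_def linear_scale)
  have K: "h \<in> K_set \<phi> x \<epsilon>" using \<open>0 < m\<close> feas assms(4) by (rule K_setI)
  show e: "eta \<phi> x \<epsilon> h \<le> m" using eta_le[OF K] feas assms by simp
  have "h \<in> K_set \<phi> x \<delta>"
    using K err err_scaleR[OF lin, of m] \<open>0 < m\<close> by (simp add: K_set_def)
  moreover have "c h = 1" using sol(2) \<open>0 < m\<close> by (simp add: cost_scale[OF hom])
  ultimately show "h \<in> H_set c \<phi> x \<epsilon> \<delta> M"
    using e \<open>m \<le> M\<close> by (simp add: H_set_def cost_ball_def)
qed

theorem theorem2p8:
  fixes c :: "'h::euclidean_space \<Rightarrow> real"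
    and \<phi> :: "'h \<Rightarrow> 'v::euclidean_space"
    and x :: 'v
    and \<epsilon> :: real
  assumes "linear \<phi>"
    and "positively_homogeneous c"
    and "compact (cost_ball c)"
    and "convex (cost_ball c)"
    and "norm x > \<epsilon>" and "\<epsilon> > 0"
    and "\<exists>f. norm (x - \<phi> f) < \<epsilon>"
  shows "(\<forall>fs. solution_of c (lip_feasible \<phi> x \<epsilon>) fs \<longrightarrow> err \<phi> x fs < \<epsilon>\<^sup>2)
    \<and> (\<forall>fs \<epsilon>' M.
          solution_of c (lip_feasible \<phi> x \<epsilon>) fs
          \<and> 0 < \<epsilon>' \<and> \<epsilon>' < \<epsilon> \<and> err \<phi> x fs \<le> \<epsilon>'\<^sup>2 \<and> \<epsilon>'\<^sup>2 < \<epsilon>\<^sup>2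
          \<and> optimal_value c (lip_feasible \<phi> x \<epsilon>) < M
          \<longrightarrow>
            convex (H_set c \<phi> x \<epsilon> \<epsilon>' M)
          \<and> convex_on (H_set c \<phi> x \<epsilon> \<epsilon>' M) (eta \<phi> x \<epsilon>)
          \<and> (\<exists>\<beta>\<ge>0. beta_smooth_on \<beta> (eta \<phi> x \<epsilon>) (H_set c \<phi> x \<epsilon> \<epsilon>' M))
          \<and> optimal_value (eta \<phi> x \<epsilon>) (H_set c \<phi> x \<epsilon> \<epsilon>' M)
              = optimal_value c (lip_feasible \<phi> x \<epsilon>)
          \<and> (\<forall>hs. solution_of (eta \<phi> x \<epsilon>) (H_set c \<phi> x \<epsilon> \<epsilon>' M) hs \<longleftrightarrow>
                solution_of c (lip_feasible \<phi> x \<epsilon>)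
                  (optimal_value c (lip_feasible \<phi> x \<epsilon>) *\<^sub>R hs)))"
proof (rule conjI)
  have bdd: "bounded (cost_ball c)" using assms(3) by (rule compact_imp_bounded)
  show "\<forall>fs. solution_of c (lip_feasible \<phi> x \<epsilon>) fs \<longrightarrow> err \<phi> x fs < \<epsilon>\<^sup>2"
    using solution_err_less[OF assms(1,2) bdd assms(4,5,6)] assms(7) by blast
  show "\<forall>fs \<epsilon>' M.
          solution_of c (lip_feasible \<phi> x \<epsilon>) fs
          \<and> 0 < \<epsilon>' \<and> \<epsilon>' < \<epsilon> \<and> err \<phi> x fs \<le> \<epsilon>'\<^sup>2 \<and> \<epsilon>'\<^sup>2 < \<epsilon>\<^sup>2
          \<and> optimal_value c (lip_feasible \<phi> x \<epsilon>) < M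
          \<longrightarrow>
            convex (H_set c \<phi> x \<epsilon> \<epsilon>' M)
          \<and> convex_on (H_set c \<phi> x \<epsilon> \<epsilon>' M) (eta \<phi> x \<epsilon>)
          \<and> (\<exists>\<beta>\<ge>0. beta_smooth_on \<beta> (eta \<phi> x \<epsilon>) (H_set c \<phi> x \<epsilon> \<epsilon>' M))
          \<and> optimal_value (eta \<phi> x \<epsilon>) (H_set c \<phi> x \<epsilon> \<epsilon>' M)
              = optimal_value c (lip_feasible \<phi> x \<epsilon>)
          \<and> (\<forall>hs. solution_of (eta \<phi> x \<epsilon>) (H_set c \<phi> x \<epsilon> \<epsilon>' M) hs \<longleftrightarrow>
                solution_of c (lip_feasible \<phi> x \<epsilon>)
                  (optimal_value c (lip_feasible \<phi> x \<epsilon>) *\<^sub>R hs))"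
  proof (intro allI impI, elim conjE)
    fix fs \<epsilon>' M
    define m where "m = optimal_value c (lip_feasible \<phi> x \<epsilon>)"
    define H where "H = H_set c \<phi> x \<epsilon> \<epsilon>' M"
    assume sol: "solution_of c (lip_feasible \<phi> x \<epsilon>) fs"
      and eps': "0 < \<epsilon>'" "\<epsilon>' < \<epsilon>" and err: "err \<phi> x fs \<le> \<epsilon>'\<^sup>2"
      and "optimal_value c (lip_feasible \<phi> x \<epsilon>) < M"
    then have "m < M" by (simp add: m_def)
    have m: "m = c fs" unfolding m_def using sol by (rule optimal_value_eq)
    have "0 < m" unfolding m
      using cost_pos[OF assms(2) bdd] lip_feasible_nonzero[OF assms(1) _ assms(5)] sol
      by (auto simp: solution_of_iff)
    have m_le: "m \<le> c f" if "f \<in> lip_feasible \<phi> x \<epsilon>" for f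
      using sol that by (simp add: m solution_of_iff)
    have HK: "h \<in> K_set \<phi> x \<epsilon>" "c h \<le> 1" if "h \<in> H" for h
      using that eps' K_set_mono[of h \<phi> x \<epsilon>' \<epsilon>] by (auto simp: H_def H_set_def cost_ball_def)
    \<comment> \<open>\<open>eta h *\<^sub>R h\<close> is feasible for the inverse problem and costs
      at most \<open>eta h\<close>.\<close>
    have lower: "m \<le> eta \<phi> x \<epsilon> h" if "h \<in> H" for h
      using lip_feasible_eta_scaleR[OF assms(1,2) _ assms(5) HK[OF that]] m_le assms(6)
      by fastforce
    have normalized: "solution_of (eta \<phi> x \<epsilon>) H h \<and> eta \<phi> x \<epsilon> h = m"
      if s: "solution_of c (lip_feasible \<phi> x \<epsilon>) (m *\<^sub>R h)" for h
    proof -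
      have "c (m *\<^sub>R h) = m" using optimal_value_eq[OF s] by (simp add: m_def)
      \<comment> \<open>\<open>err\<close> depends on a point only through its image under \<phi>,
        which all solutions share, so the bound assumed for \<open>fs\<close> passes to
        \<open>m *\<^sub>R h\<close>.\<close>
      moreover have "err \<phi> x (m *\<^sub>R h) \<le> \<epsilon>'\<^sup>2"
        using err solution_image_unique[OF assms(1,2) bdd assms(4,5) s sol]
        by (simp add: err_def)
      ultimately have "h \<in> H" "eta \<phi> x \<epsilon> h \<le> m"
        using normalized_solution[OF assms(1,2), of \<epsilon> x m M h \<epsilon>'] s eps' assms(5,6)
          \<open>0 < m\<close> \<open>m < M\<close> by (simp_all add: H_def)
      then show ?thesis using lower by (force simp: solution_of_iff)
    qed
    have attained: "solution_of (eta \<phi> x \<epsilon>) H ((1/m) *\<^sub>R fs)" "eta \<phi> x \<epsilon> ((1/m) *\<^sub>R fs) = m"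
      using normalized[of "(1/m) *\<^sub>R fs"] sol \<open>0 < m\<close> by simp_all
    have opt: "optimal_value (eta \<phi> x \<epsilon>) H = m"
      using optimal_value_eq[OF attained(1)] attained(2) by simp
    have iff: "solution_of (eta \<phi> x \<epsilon>) H hs \<longleftrightarrow> solution_of c (lip_feasible \<phi> x \<epsilon>) (m *\<^sub>R hs)" for hs
    proof
      assume s: "solution_of (eta \<phi> x \<epsilon>) H hs"
      then have "eta \<phi> x \<epsilon> hs = m" "hs \<in> H"
        using optimal_value_eq[OF s] opt by (auto simp: solution_of_iff)
      \<comment> \<open>Here \<open>eta hs = m\<close>, so the scaled point is feasible with cost at
        most the optimal value.\<close>
      then have "m *\<^sub>R hs \<in> lip_feasible \<phi> x \<epsilon>" "c (m *\<^sub>R hs) \<le> m"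
        using lip_feasible_eta_scaleR[OF assms(1,2) _ assms(5) HK[OF \<open>hs \<in> H\<close>]] assms(6) by auto
      then show "solution_of c (lip_feasible \<phi> x \<epsilon>) (m *\<^sub>R hs)"
        using m_le by (force simp: solution_of_iff)
    qed (simp add: normalized)
    show "convex (H_set c \<phi> x \<epsilon> \<epsilon>' M)
          \<and> convex_on (H_set c \<phi> x \<epsilon> \<epsilon>' M) (eta \<phi> x \<epsilon>)
          \<and> (\<exists>\<beta>\<ge>0. beta_smooth_on \<beta> (eta \<phi> x \<epsilon>) (H_set c \<phi> x \<epsilon> \<epsilon>' M))
          \<and> optimal_value (eta \<phi> x \<epsilon>) (H_set c \<phi> x \<epsilon> \<epsilon>' M)
              = optimal_value c (lip_feasible \<phi> x \<epsilon>)
          \<and> (\<forall>hs. solution_of (eta \<phi> x \<epsilon>) (H_set c \<phi> x \<epsilon> \<epsilon>' M) hs \<longleftrightarrow>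
                solution_of c (lip_feasible \<phi> x \<epsilon>)
                  (optimal_value c (lip_feasible \<phi> x \<epsilon>) *\<^sub>R hs))"
      unfolding m_def[symmetric] H_def[symmetric]
    proof (intro conjI allI)
      have e: "0 \<le> \<epsilon>'" "\<epsilon>' \<le> \<epsilon>" and "0 < M" using eps' \<open>0 < m\<close> \<open>m < M\<close> by simp_all
      show "convex H" "convex_on H (eta \<phi> x \<epsilon>)"
        unfolding H_def using assms(1,4) e assms(5) by (rule convex_H_set, rule convex_on_eta_H_set)
      show "\<exists>\<beta>\<ge>0. beta_smooth_on \<beta> (eta \<phi> x \<epsilon>) H"
        unfolding H_def using assms(1) bdd e(1) eps'(2) assms(5) \<open>0 < M\<close> by (rule beta_smooth_on_eta)
    qed (rule opt iff)+
  qed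
qed

end
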